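(* Let $\mathcal C=(C,G,\delta)$ be a crossed module of groupoids with object set $X$. There is an action of $\mathrm{Aut}(\mathcal C)$ on $FDer^*(\mathcal C)$ given, for $s\in FDer^*(\mathcal C)$ and $f=(f_0,f_1,f_2)\in\mathrm{Aut}(\mathcal C)$, by $$s^f(z)=\begin{cases} f_1^{-1}s_0f_0(z), & z\in X,\\ f_2^{-1}s_1f_1(z), & z\in G,\end{cases}$$ which makes $\Delta:FDer^*(\mathcal C)\to\mathrm{Aut}(\mathcal C)$ a pre-crossed module.
   Context: Conventions: the source and target maps of a groupoid are $\alpha,\beta$; composition is written additively, $a+b$ being defined when $\beta a=\alpha b$; $-a$ is the inverse of $a$; $G(x,y)$ is the set of $a\in G$ with $\alpha a=x$, $\beta a=y$. A groupoid is totally intransitive if $\alpha=\beta$. Action: if $G,C$ are groupoids over the same object set and $C$ is totally intransitive, an action of $G$ on $C$ is a partial function $(c,a)\mapsto c^a$, defined iff $\beta(c)=\alpha(a)$, with $\beta(c^a)=\beta(a)$, $(c_1+c_2)^a=c_1^a+c_2^a$, $c^{a+b}=(c^a)^b$, and $c^{e_x}=c$ for identities $e_x$. A crossed module of groupoids $\mathcal C=(C,G,\delta)$ consists of groupoids $C,G$ over the same object set $X$ with $C$ totally intransitive, a groupoid morphism $\delta:C\to G$ which is the identity on objects, and an action of $G$ on $C$ with $\delta(c^a)=-a+\delta c+a$ and $c^{\delta c_1}=-c_1+c+c_1$ for $c,c_1\in C(x,x)$, $a\in G(x,y)$. An endomorphism of $\mathcal C$ is a triple $f=(f_0,f_1,f_2)$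 with $f_1:G\to G$, $f_2:C\to C$ groupoid morphisms having the same object map $f_0:X\to X$, such that $\delta f_2=f_1\delta$ and $f_2(c^a)=f_2(c)^{f_1(a)}$. $\mathrm{Aut}(\mathcal C)$ is the group of invertible endomorphisms, with product $fg=f\circ g$. A free derivation on $\mathcal C$ is a pair $s=(s_0,s_1)$ of functions $s_0:X\to G$, $s_1:G\to C$ such that $\beta(s_0x)=x$, $\beta(s_1a)=\beta a$, and $s_1(a+b)=s_1(a)^b+s_1(b)$ whenever $a+b$ is defined; one writes $s(z)=s_0(z)$ for $z\in X$ and $s(z)=s_1(z)$ for $z\in G$. $FDer(\mathcal C)$ is the set of free derivations. For a free derivation $s$, $\Delta(s)=f=(f_0,f_1,f_2)$ is the endomorphism of $\mathcal C$ given by $f_0(x)=\alpha s_0(x)$, $f_1(a)=s_0(\alpha a)+a+\delta s_1(a)-s_0(\beta a)$, $f_2(c)=(c+s_1\delta c)^{-s_0(\beta c)}$. $FDer(\mathcal C)$ is a monoid under $(s*t)_0(x)=s_0(g_0(x))+t_0(x)$ for $x\in X$, $(s*t)_1(a)=t_1(a)+(s_1(g_1(a)))^{t_0(\beta a)}$ for $a\in G$, where $g=\Delta(t)$; its identity is the pair with $s_0(x)$ the identity at $x$ and $s_1(a)$ the identity of $C$ at $\beta a$. $FDer^*(\mathcal C)$ is the group of invertible elements of this monoid, and $\Delta$ restricts to a group morphism $FDer^*(\mathcal C)\to\mathrm{Aut}(\mathcal C)$. A pre-crossed module of groups is a group homomorphism $\mu:N\to P$ with a right action $(n,p)\mapsto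 n^p$ of $P$ on $N$ by group automorphisms satisfying $\mu(n^p)=p^{-1}\mu(n)p$. *)

theory Defs
  imports "HOL-Algebra.Group"
begin

text \<open>
  Groupoids are written additively and live on explicit carrier sets: \<open>a \<boxplus> b\<close> is meaningful only
  when \<open>\<beta> a = \<alpha> b\<close>, so composition runs from left to right.
\<close>

record ('x, 'a) gpd =
  Obj :: "'x set"
  Arr :: "'a set"
  src :: "'a \<Rightarrow> 'x"  ("\<alpha>\<index>")
  tgt :: "'a \<Rightarrow> 'x"  ("\<beta>\<index>")
  gplus :: "'a \<Rightarrow> 'a \<Rightarrow> 'a"  (infixl "\<boxplus>\<index>" 65)
  gident :: "'x \<Rightarrow> 'a"
  gneg :: "'a \<Rightarrow> 'a"  ("\<boxminus>\<index> _" [81] 80)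

locale groupoid =
  fixes G :: "('x, 'a) gpd" (structure)
  assumes src_closed: "a \<in> Arr G \<Longrightarrow> \<alpha> a \<in> Obj G"
    and tgt_closed: "a \<in> Arr G \<Longrightarrow> \<beta> a \<in> Obj G"
    and plus_closed: "\<lbrakk>a \<in> Arr G; b \<in> Arr G; \<beta> a = \<alpha> b\<rbrakk> \<Longrightarrow> a \<boxplus> b \<in> Arr G"
    and src_plus: "\<lbrakk>a \<in> Arr G; b \<in> Arr G; \<beta> a = \<alpha> b\<rbrakk> \<Longrightarrow> \<alpha> (a \<boxplus> b) = \<alpha> a"
    and tgt_plus: "\<lbrakk>a \<in> Arr G; b \<in> Arr G; \<beta> a = \<alpha> b\<rbrakk> \<Longrightarrow> \<beta> (a \<boxplus> b) = \<beta> b"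
    and plus_assoc: "\<lbrakk>a \<in> Arr G; b \<in> Arr G; c \<in> Arr G; \<beta> a = \<alpha> b; \<beta> b = \<alpha> c\<rbrakk>
          \<Longrightarrow> (a \<boxplus> b) \<boxplus> c = a \<boxplus> (b \<boxplus> c)"
    and ident_closed: "x \<in> Obj G \<Longrightarrow> gident G x \<in> Arr G"
    and src_ident: "x \<in> Obj G \<Longrightarrow> \<alpha> (gident G x) = x"
    and tgt_ident: "x \<in> Obj G \<Longrightarrow> \<beta> (gident G x) = x"
    and ident_left: "a \<in> Arr G \<Longrightarrow> gident G (\<alpha> a) \<boxplus> a = a"
    and ident_right: "a \<in> Arr G \<Longrightarrow> a \<boxplus> gident G (\<beta> a) = a"
    and neg_closed: "a \<in> Arr G \<Longrightarrow> \<boxminus> a \<in> Arr G"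
    and src_neg: "a \<in> Arr G \<Longrightarrow> \<alpha> (\<boxminus> a) = \<beta> a"
    and tgt_neg: "a \<in> Arr G \<Longrightarrow> \<beta> (\<boxminus> a) = \<alpha> a"
    and neg_right: "a \<in> Arr G \<Longrightarrow> a \<boxplus> (\<boxminus> a) = gident G (\<alpha> a)"
    and neg_left: "a \<in> Arr G \<Longrightarrow> (\<boxminus> a) \<boxplus> a = gident G (\<beta> a)"

locale totally_intransitive_groupoid = groupoid +
  assumes src_eq_tgt: "a \<in> Arr G \<Longrightarrow> \<alpha> a = \<beta> a"

definition groupoid_morphism ::
    "('x, 'a) gpd \<Rightarrow> ('y, 'b) gpd \<Rightarrow> ('x \<Rightarrow> 'y) \<Rightarrow> ('a \<Rightarrow> 'b) \<Rightarrow> bool" where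
  "groupoid_morphism G H f0 f1 \<longleftrightarrow>
     f0 \<in> Obj G \<rightarrow> Obj H \<and> f1 \<in> Arr G \<rightarrow> Arr H \<and>
     (\<forall>a\<in>Arr G. \<alpha>\<^bsub>H\<^esub> (f1 a) = f0 (\<alpha>\<^bsub>G\<^esub> a) \<and> \<beta>\<^bsub>H\<^esub> (f1 a) = f0 (\<beta>\<^bsub>G\<^esub> a)) \<and>
     (\<forall>a\<in>Arr G. \<forall>b\<in>Arr G. \<beta>\<^bsub>G\<^esub> a = \<alpha>\<^bsub>G\<^esub> b \<longrightarrow> f1 (a \<boxplus>\<^bsub>G\<^esub> b) = f1 a \<boxplus>\<^bsub>H\<^esub> f1 b)"

text \<open>\<open>act c a\<close> stands for $c^a$; it is meaningful only when \<open>\<beta> c = \<alpha> a\<close>.\<close>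

locale groupoid_action =
  C: totally_intransitive_groupoid C + G: groupoid G
  for C :: "('x, 'c) gpd" and G :: "('x, 'g) gpd" and act :: "'c \<Rightarrow> 'g \<Rightarrow> 'c" +
  assumes same_objects: "Obj C = Obj G"
    and act_closed: "\<lbrakk>c \<in> Arr C; a \<in> Arr G; \<beta>\<^bsub>C\<^esub> c = \<alpha>\<^bsub>G\<^esub> a\<rbrakk> \<Longrightarrow> act c a \<in> Arr C"
    and tgt_act: "\<lbrakk>c \<in> Arr C; a \<in> Arr G; \<beta>\<^bsub>C\<^esub> c = \<alpha>\<^bsub>G\<^esub> a\<rbrakk> \<Longrightarrow> \<beta>\<^bsub>C\<^esub> (act c a) = \<beta>\<^bsub>G\<^esub> a"
    and act_plus: "\<lbrakk>c \<in> Arr C; d \<in> Arr C; a \<in> Arr G; \<beta>\<^bsub>C\<^esub> c = \<alpha>\<^bsub>C\<^esub> d; \<beta>\<^bsub>C\<^esub> d = \<alpha>\<^bsub>G\<^esub> a\<rbrakk>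
          \<Longrightarrow> act (c \<boxplus>\<^bsub>C\<^esub> d) a = act c a \<boxplus>\<^bsub>C\<^esub> act d a"
    and act_act: "\<lbrakk>c \<in> Arr C; a \<in> Arr G; b \<in> Arr G; \<beta>\<^bsub>C\<^esub> c = \<alpha>\<^bsub>G\<^esub> a; \<beta>\<^bsub>G\<^esub> a = \<alpha>\<^bsub>G\<^esub> b\<rbrakk>
          \<Longrightarrow> act c (a \<boxplus>\<^bsub>G\<^esub> b) = act (act c a) b"
    and act_ident: "c \<in> Arr C \<Longrightarrow> act c (gident G (\<beta>\<^bsub>C\<^esub> c)) = c"

locale crossed_module = groupoid_action C G act
  for C :: "('x, 'c) gpd" and G :: "('x, 'g) gpd"
    and \<delta> :: "'c \<Rightarrow> 'g" and act :: "'c \<Rightarrow> 'g \<Rightarrow> 'c" +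
  assumes boundary_morphism: "groupoid_morphism C G (\<lambda>x. x) \<delta>"
    and boundary_act: "\<lbrakk>c \<in> Arr C; a \<in> Arr G; \<beta>\<^bsub>C\<^esub> c = \<alpha>\<^bsub>G\<^esub> a\<rbrakk>
          \<Longrightarrow> \<delta> (act c a) = (\<boxminus>\<^bsub>G\<^esub> a) \<boxplus>\<^bsub>G\<^esub> \<delta> c \<boxplus>\<^bsub>G\<^esub> a"
    and peiffer: "\<lbrakk>c \<in> Arr C; d \<in> Arr C; \<beta>\<^bsub>C\<^esub> c = \<beta>\<^bsub>C\<^esub> d\<rbrakk>
          \<Longrightarrow> act c (\<delta> d) = (\<boxminus>\<^bsub>C\<^esub> d) \<boxplus>\<^bsub>C\<^esub> c \<boxplus>\<^bsub>C\<^esub> d"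

text \<open>
  Endomorphisms and derivations are functions on \<open>Obj G\<close>, \<open>Arr G\<close> and \<open>Arr C\<close>. They are taken
  extensional (\<open>undefined\<close> outside the carrier), so that equality of the HOL functions is equality
  of the functions on the carriers.
\<close>

type_synonym ('x, 'g, 'c) endo = "('x \<Rightarrow> 'x) \<times> ('g \<Rightarrow> 'g) \<times> ('c \<Rightarrow> 'c)"

type_synonym ('x, 'g, 'c) deriv = "('x \<Rightarrow> 'g) \<times> ('g \<Rightarrow> 'c)"

definition endomorphisms ::
    "('x, 'c) gpd \<Rightarrow> ('x, 'g) gpd \<Rightarrow> ('c \<Rightarrow> 'g) \<Rightarrow> ('c \<Rightarrow> 'g \<Rightarrow> 'c) \<Rightarrow> ('x, 'g, 'c) endo set" where
  "endomorphisms C G \<delta> act = {(f0, f1, f2).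
     f0 \<in> extensional (Obj G) \<and> f1 \<in> extensional (Arr G) \<and> f2 \<in> extensional (Arr C) \<and>
     groupoid_morphism G G f0 f1 \<and> groupoid_morphism C C f0 f2 \<and>
     (\<forall>c\<in>Arr C. \<delta> (f2 c) = f1 (\<delta> c)) \<and>
     (\<forall>c\<in>Arr C. \<forall>a\<in>Arr G. \<beta>\<^bsub>C\<^esub> c = \<alpha>\<^bsub>G\<^esub> a \<longrightarrow> f2 (act c a) = act (f2 c) (f1 a))}"

definition End_monoid ::
    "('x, 'c) gpd \<Rightarrow> ('x, 'g) gpd \<Rightarrow> ('c \<Rightarrow> 'g) \<Rightarrow> ('c \<Rightarrow> 'g \<Rightarrow> 'c) \<Rightarrow> ('x, 'g, 'c) endo monoid" where
  "End_monoid C G \<delta> act = \<lparr>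
     carrier = endomorphisms C G \<delta> act,
     mult = (\<lambda>(f0, f1, f2) (g0, g1, g2).
       (compose (Obj G) f0 g0, compose (Arr G) f1 g1, compose (Arr C) f2 g2)),
     one = (\<lambda>x\<in>Obj G. x, \<lambda>a\<in>Arr G. a, \<lambda>c\<in>Arr C. c)\<rparr>"

definition Aut_group ::
    "('x, 'c) gpd \<Rightarrow> ('x, 'g) gpd \<Rightarrow> ('c \<Rightarrow> 'g) \<Rightarrow> ('c \<Rightarrow> 'g \<Rightarrow> 'c) \<Rightarrow> ('x, 'g, 'c) endo monoid" where
  "Aut_group C G \<delta> act = units_of (End_monoid C G \<delta> act)"

definition free_derivations ::
    "('x, 'c) gpd \<Rightarrow> ('x, 'g) gpd \<Rightarrow> ('c \<Rightarrow> 'g \<Rightarrow> 'c) \<Rightarrow> ('x, 'g, 'c) deriv set" where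
  "free_derivations C G act = {(s0, s1).
     s0 \<in> Obj G \<rightarrow>\<^sub>E Arr G \<and> s1 \<in> Arr G \<rightarrow>\<^sub>E Arr C \<and>
     (\<forall>x\<in>Obj G. \<beta>\<^bsub>G\<^esub> (s0 x) = x) \<and> (\<forall>a\<in>Arr G. \<beta>\<^bsub>C\<^esub> (s1 a) = \<beta>\<^bsub>G\<^esub> a) \<and>
     (\<forall>a\<in>Arr G. \<forall>b\<in>Arr G. \<beta>\<^bsub>G\<^esub> a = \<alpha>\<^bsub>G\<^esub> b \<longrightarrow>
        s1 (a \<boxplus>\<^bsub>G\<^esub> b) = act (s1 a) b \<boxplus>\<^bsub>C\<^esub> s1 b)}"

definition Delta ::
    "('x, 'c) gpd \<Rightarrow> ('x, 'g) gpd \<Rightarrow> ('c \<Rightarrow> 'g) \<Rightarrow> ('c \<Rightarrow> 'g \<Rightarrow> 'c) \<Rightarrow>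
     ('x, 'g, 'c) deriv \<Rightarrow> ('x, 'g, 'c) endo" where
  "Delta C G \<delta> act = (\<lambda>(s0, s1).
     (\<lambda>x\<in>Obj G. \<alpha>\<^bsub>G\<^esub> (s0 x),
      \<lambda>a\<in>Arr G. s0 (\<alpha>\<^bsub>G\<^esub> a) \<boxplus>\<^bsub>G\<^esub> a \<boxplus>\<^bsub>G\<^esub> \<delta> (s1 a) \<boxplus>\<^bsub>G\<^esub> (\<boxminus>\<^bsub>G\<^esub> (s0 (\<beta>\<^bsub>G\<^esub> a))),
      \<lambda>c\<in>Arr C. act (c \<boxplus>\<^bsub>C\<^esub> s1 (\<delta> c)) (\<boxminus>\<^bsub>G\<^esub> (s0 (\<beta>\<^bsub>C\<^esub> c)))))"

definition FDer_monoid ::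
    "('x, 'c) gpd \<Rightarrow> ('x, 'g) gpd \<Rightarrow> ('c \<Rightarrow> 'g) \<Rightarrow> ('c \<Rightarrow> 'g \<Rightarrow> 'c) \<Rightarrow> ('x, 'g, 'c) deriv monoid" where
  "FDer_monoid C G \<delta> act = \<lparr>
     carrier = free_derivations C G act,
     mult = (\<lambda>(s0, s1) (t0, t1).
       let (g0, g1, g2) = Delta C G \<delta> act (t0, t1) in
       (\<lambda>x\<in>Obj G. s0 (g0 x) \<boxplus>\<^bsub>G\<^esub> t0 x,
        \<lambda>a\<in>Arr G. t1 a \<boxplus>\<^bsub>C\<^esub> act (s1 (g1 a)) (t0 (\<beta>\<^bsub>G\<^esub> a)))),
     one = (\<lambda>x\<in>Obj G. gident G x, \<lambda>a\<in>Arr G. gident C (\<beta>\<^bsub>G\<^esub> a))\<rparr>"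

definition FDer_star ::
    "('x, 'c) gpd \<Rightarrow> ('x, 'g) gpd \<Rightarrow> ('c \<Rightarrow> 'g) \<Rightarrow> ('c \<Rightarrow> 'g \<Rightarrow> 'c) \<Rightarrow> ('x, 'g, 'c) deriv monoid" where
  "FDer_star C G \<delta> act = units_of (FDer_monoid C G \<delta> act)"

text \<open>\<open>ract n p\<close> stands for $n^p$.\<close>

locale right_group_action = N: group N + P: group P
  for N :: "'n monoid" and P :: "'p monoid" and ract :: "'n \<Rightarrow> 'p \<Rightarrow> 'n" +
  assumes ract_auto: "p \<in> carrier P \<Longrightarrow> (\<lambda>n. ract n p) \<in> iso N N"
    and ract_one: "n \<in> carrier N \<Longrightarrow> ract n \<one>\<^bsub>P\<^esub> = n"
    and ract_mult: "\<lbrakk>n \<in> carrier N; p \<in> carrier P; q \<in> carrier P\<rbrakk>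
          \<Longrightarrow> ract n (p \<otimes>\<^bsub>P\<^esub> q) = ract (ract n p) q"

locale pre_crossed_module = right_group_action N P ract
  for N :: "'n monoid" and P :: "'p monoid" and \<mu> :: "'n \<Rightarrow> 'p" and ract :: "'n \<Rightarrow> 'p \<Rightarrow> 'n" +
  assumes hom: "\<mu> \<in> hom N P"
    and equivariant: "\<lbrakk>n \<in> carrier N; p \<in> carrier P\<rbrakk>
          \<Longrightarrow> \<mu> (ract n p) = inv\<^bsub>P\<^esub> p \<otimes>\<^bsub>P\<^esub> \<mu> n \<otimes>\<^bsub>P\<^esub> p"

end

theory Submission
  imports Defs
begin

text \<open>
  The map \<open>\<Delta>\<close> turns the product of free derivations into composition of endomorphisms, which gives
  associativity of that product. For an automorphism \<open>f\<close> with inverse \<open>g\<close>, \<open>s\<^sup>f\<close> is the conjugate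
  \<open>(g\<^sub>1 s\<^sub>0 f\<^sub>0, g\<^sub>2 s\<^sub>1 f\<^sub>1)\<close>, and \<open>\<Delta>(s\<^sup>f) = g \<Delta>(s) f\<close> because \<open>g\<close> preserves all the operations
  occurring in \<open>\<Delta>(s)\<close>. As \<open>\<Delta>\<close> also governs the product, conjugation is a monoid endomorphism of the
  free derivations, so it restricts to the units.
\<close>

section \<open>Groupoids\<close>

context groupoid
begin

declare src_closed [simp] tgt_closed [simp] plus_closed [simp] src_plus [simp] tgt_plus [simp]
  plus_assoc [simp] ident_closed [simp] src_ident [simp] tgt_ident [simp] neg_closed [simp]
  src_neg [simp] tgt_neg [simp] neg_right [simp] neg_left [simp]

lemma ident_left' [simp]: "\<lbrakk>a \<in> Arr G; \<alpha> a = x\<rbrakk> \<Longrightarrow> gident G x \<boxplus> a = a"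
  using ident_left by blast

lemma ident_right' [simp]: "\<lbrakk>a \<in> Arr G; \<beta> a = x\<rbrakk> \<Longrightarrow> a \<boxplus> gident G x = a"
  using ident_right by blast

lemma neg_plus_cancel [simp]:
  "\<lbrakk>a \<in> Arr G; b \<in> Arr G; \<beta> a = \<alpha> b\<rbrakk> \<Longrightarrow> (\<boxminus> a) \<boxplus> (a \<boxplus> b) = b"
  by (simp flip: plus_assoc)

lemma plus_neg_cancel [simp]:
  "\<lbrakk>a \<in> Arr G; b \<in> Arr G; \<alpha> a = \<alpha> b\<rbrakk> \<Longrightarrow> a \<boxplus> ((\<boxminus> a) \<boxplus> b) = b"
  by (simp flip: plus_assoc)

lemma neg_unique:
  assumes "a \<in> Arr G" "b \<in> Arr G" "\<beta> a = \<alpha> b" "a \<boxplus> b = gident G (\<alpha> a)"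
  shows "b = \<boxminus> a"
proof -
  have "b = (\<boxminus> a) \<boxplus> (a \<boxplus> b)"
    using assms(1-3) by simp
  then show ?thesis
    using assms by simp
qed

lemma neg_neg [simp]: "a \<in> Arr G \<Longrightarrow> \<boxminus> (\<boxminus> a) = a"
  using neg_unique [of "\<boxminus> a" a] by simp

lemma neg_plus [simp]:
  assumes "a \<in> Arr G" "b \<in> Arr G" "\<beta> a = \<alpha> b"
  shows "\<boxminus> (a \<boxplus> b) = (\<boxminus> b) \<boxplus> (\<boxminus> a)"
  using assms by (intro neg_unique [symmetric]) simp_all

lemma neg_ident [simp]: "x \<in> Obj G \<Longrightarrow> \<boxminus> (gident G x) = gident G x"
  by (intro neg_unique [symmetric]) simp_all

text \<open>Cancel one copy of \<open>a\<close>. Morphisms, actions and derivations are only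
  required to respect sums; this is how they are shown to send identities to identities.\<close>

lemma idempotent_is_ident:
  assumes "a \<in> Arr G" "\<alpha> a = \<beta> a" "a \<boxplus> a = a"
  shows "a = gident G (\<beta> a)"
proof -
  have "a = (\<boxminus> a) \<boxplus> (a \<boxplus> a)"
    using assms(1,2) by simp
  then show ?thesis
    using assms by simp
qed

end

lemma (in totally_intransitive_groupoid) src_eq_tgt' [simp]: "a \<in> Arr G \<Longrightarrow> \<alpha> a = \<beta> a"
  by (rule src_eq_tgt)

locale groupoid_hom = G: groupoid G + H: groupoid H
  for G :: "('x, 'a) gpd" and H :: "('y, 'b) gpd" +
  fixes f0 f1
  assumes morphism: "groupoid_morphism G H f0 f1"
begin

lemma obj_closed [simp]: "x \<in> Obj G \<Longrightarrow> f0 x \<in> Obj H"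
  and arr_closed [simp]: "a \<in> Arr G \<Longrightarrow> f1 a \<in> Arr H"
  and src_hom [simp]: "a \<in> Arr G \<Longrightarrow> \<alpha>\<^bsub>H\<^esub> (f1 a) = f0 (\<alpha>\<^bsub>G\<^esub> a)"
  and tgt_hom [simp]: "a \<in> Arr G \<Longrightarrow> \<beta>\<^bsub>H\<^esub> (f1 a) = f0 (\<beta>\<^bsub>G\<^esub> a)"
  and hom_plus [simp]: "\<lbrakk>a \<in> Arr G; b \<in> Arr G; \<beta>\<^bsub>G\<^esub> a = \<alpha>\<^bsub>G\<^esub> b\<rbrakk>
    \<Longrightarrow> f1 (a \<boxplus>\<^bsub>G\<^esub> b) = f1 a \<boxplus>\<^bsub>H\<^esub> f1 b"
  using morphism by (auto simp: groupoid_morphism_def)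

lemma hom_ident [simp]:
  assumes "x \<in> Obj G"
  shows "f1 (gident G x) = gident H (f0 x)"
proof -
  have "f1 (gident G x) \<boxplus>\<^bsub>H\<^esub> f1 (gident G x) = f1 (gident G x)"
    using assms by (simp flip: hom_plus)
  then show ?thesis
    using H.idempotent_is_ident [of "f1 (gident G x)"] assms by simp
qed

lemma hom_neg [simp]:
  assumes "a \<in> Arr G"
  shows "f1 (\<boxminus>\<^bsub>G\<^esub> a) = \<boxminus>\<^bsub>H\<^esub> (f1 a)"
  using assms by (intro H.neg_unique) (simp_all flip: hom_plus)

end

section \<open>Crossed modules and free derivations\<close>

context groupoid_action
begin

lemma obj_eq [simp]: "Obj C = Obj G"
  by (rule same_objects)

lemma tgt_closed_C [simp]: "c \<in> Arr C \<Longrightarrow> \<beta>\<^bsub>C\<^esub> c \<in> Obj G"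
  using C.tgt_closed by simp

declare act_closed [simp] tgt_act [simp] act_plus [simp] act_act [simp]

lemma act_ident' [simp]: "\<lbrakk>c \<in> Arr C; \<beta>\<^bsub>C\<^esub> c = x\<rbrakk> \<Longrightarrow> act c (gident G x) = c"
  using act_ident by blast

lemma ident_act [simp]:
  assumes "a \<in> Arr G" "x = \<alpha>\<^bsub>G\<^esub> a"
  shows "act (gident C x) a = gident C (\<beta>\<^bsub>G\<^esub> a)"
proof -
  have "act (gident C x) a \<boxplus>\<^bsub>C\<^esub> act (gident C x) a = act (gident C x) a"
    using assms by (simp flip: act_plus)
  then show ?thesis
    using C.idempotent_is_ident [of "act (gident C x) a"] assms by simp
qed

lemma neg_act [simp]:
  assumes "c \<in> Arr C" "a \<in> Arr G" "\<beta>\<^bsub>C\<^esub> c = \<alpha>\<^bsub>G\<^esub> a"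
  shows "act (\<boxminus>\<^bsub>C\<^esub> c) a = \<boxminus>\<^bsub>C\<^esub> (act c a)"
  using assms by (intro C.neg_unique) (simp_all flip: act_plus)

lemma act_act_neg [simp]:
  assumes "c \<in> Arr C" "a \<in> Arr G" "\<beta>\<^bsub>C\<^esub> c = \<alpha>\<^bsub>G\<^esub> a"
  shows "act (act c a) (\<boxminus>\<^bsub>G\<^esub> a) = c"
  using assms by (simp flip: act_act)

lemma act_neg_act [simp]:
  assumes "c \<in> Arr C" "a \<in> Arr G" "\<beta>\<^bsub>C\<^esub> c = \<beta>\<^bsub>G\<^esub> a"
  shows "act (act c (\<boxminus>\<^bsub>G\<^esub> a)) a = c"
  using assms by (simp flip: act_act)

end

context crossed_module
begin

sublocale boundary: groupoid_hom C G "\<lambda>x. x" \<delta>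
  using boundary_morphism by unfold_locales

declare boundary_act [simp] peiffer [simp]

end

section \<open>Free derivations and the endomorphism Delta(s)\<close>

locale free_derivation = crossed_module C G \<delta> act
  for C :: "('x, 'c) gpd" and G :: "('x, 'g) gpd"
    and \<delta> :: "'c \<Rightarrow> 'g" and act :: "'c \<Rightarrow> 'g \<Rightarrow> 'c" +
  fixes s0 :: "'x \<Rightarrow> 'g" and s1 :: "'g \<Rightarrow> 'c"
  assumes derivation: "(s0, s1) \<in> free_derivations C G act"
begin

lemma s0_closed [simp]: "x \<in> Obj G \<Longrightarrow> s0 x \<in> Arr G"
  and s1_closed [simp]: "a \<in> Arr G \<Longrightarrow> s1 a \<in> Arr C"
  and tgt_s0 [simp]: "x \<in> Obj G \<Longrightarrow> \<beta>\<^bsub>G\<^esub> (s0 x) = x"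
  and tgt_s1 [simp]: "a \<in> Arr G \<Longrightarrow> \<beta>\<^bsub>C\<^esub> (s1 a) = \<beta>\<^bsub>G\<^esub> a"
  and s1_plus [simp]: "\<lbrakk>a \<in> Arr G; b \<in> Arr G; \<beta>\<^bsub>G\<^esub> a = \<alpha>\<^bsub>G\<^esub> b\<rbrakk>
    \<Longrightarrow> s1 (a \<boxplus>\<^bsub>G\<^esub> b) = act (s1 a) b \<boxplus>\<^bsub>C\<^esub> s1 b"
  and s0_extensional: "s0 \<in> extensional (Obj G)"
  and s1_extensional: "s1 \<in> extensional (Arr G)"
  using derivation by (auto simp: free_derivations_def PiE_def)

lemma s1_ident [simp]:
  assumes "x \<in> Obj G"
  shows "s1 (gident G x) = gident C x"
proof -
  have "s1 (gident G x) \<boxplus>\<^bsub>C\<^esub> s1 (gident G x) = s1 (gident G x)"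
    using assms s1_plus [of "gident G x" "gident G x"] by simp
  then show ?thesis
    using C.idempotent_is_ident [of "s1 (gident G x)"] assms by simp
qed

text \<open>The derivation rule for a + (-a) says that s1(a)^(-a) + s1(-a) is an identity, which
  determines s1(-a).\<close>

lemma s1_neg [simp]:
  assumes "a \<in> Arr G"
  shows "s1 (\<boxminus>\<^bsub>G\<^esub> a) = \<boxminus>\<^bsub>C\<^esub> (act (s1 a) (\<boxminus>\<^bsub>G\<^esub> a))"
  using assms s1_plus [of a "\<boxminus>\<^bsub>G\<^esub> a"] by (intro C.neg_unique) simp_all

text \<open>\<open>D0\<close>, \<open>D1\<close> and \<open>D2\<close> are the components of
  \<open>Delta\<close> without the restriction to the carriers, so that they can have simplification
  rules of their own. The rule \<open>src_s0\<close> below folds sources into \<open>D0\<close>, so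
  it has to be removed where \<open>D0_def\<close> is unfolded afterwards.\<close>

definition D0 where "D0 x = \<alpha>\<^bsub>G\<^esub> (s0 x)"

definition D1 where
  "D1 a = s0 (\<alpha>\<^bsub>G\<^esub> a) \<boxplus>\<^bsub>G\<^esub> a \<boxplus>\<^bsub>G\<^esub> \<delta> (s1 a) \<boxplus>\<^bsub>G\<^esub> (\<boxminus>\<^bsub>G\<^esub> (s0 (\<beta>\<^bsub>G\<^esub> a)))"

definition D2 where "D2 c = act (c \<boxplus>\<^bsub>C\<^esub> s1 (\<delta> c)) (\<boxminus>\<^bsub>G\<^esub> (s0 (\<beta>\<^bsub>C\<^esub> c)))"

lemma Delta_eq: "Delta C G \<delta> act (s0, s1) = (\<lambda>x\<in>Obj G. D0 x, \<lambda>a\<in>Arr G. D1 a, \<lambda>c\<in>Arr C. D2 c)"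
  by (simp add: Delta_def D0_def D1_def D2_def)

lemma src_s0 [simp]: "\<alpha>\<^bsub>G\<^esub> (s0 x) = D0 x"
  by (simp add: D0_def)

lemma D0_closed [simp]: "x \<in> Obj G \<Longrightarrow> D0 x \<in> Obj G"
  by (simp add: D0_def del: src_s0)

lemma D1_closed [simp]: "a \<in> Arr G \<Longrightarrow> D1 a \<in> Arr G"
  and src_D1 [simp]: "a \<in> Arr G \<Longrightarrow> \<alpha>\<^bsub>G\<^esub> (D1 a) = D0 (\<alpha>\<^bsub>G\<^esub> a)"
  and tgt_D1 [simp]: "a \<in> Arr G \<Longrightarrow> \<beta>\<^bsub>G\<^esub> (D1 a) = D0 (\<beta>\<^bsub>G\<^esub> a)"
  by (simp_all add: D1_def)

text \<open>Expands \<open>D1 a\<close> only where it is a left summand. An occurrence as the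
  argument of another derivation stays folded, which is needed in \<open>D1_mult\<close>.\<close>

lemma D1_plus_left:
  "\<lbrakk>a \<in> Arr G; b \<in> Arr G; \<alpha>\<^bsub>G\<^esub> b = D0 (\<beta>\<^bsub>G\<^esub> a)\<rbrakk> \<Longrightarrow> D1 a \<boxplus>\<^bsub>G\<^esub> b =
    s0 (\<alpha>\<^bsub>G\<^esub> a) \<boxplus>\<^bsub>G\<^esub> (a \<boxplus>\<^bsub>G\<^esub> (\<delta> (s1 a) \<boxplus>\<^bsub>G\<^esub> ((\<boxminus>\<^bsub>G\<^esub> (s0 (\<beta>\<^bsub>G\<^esub> a))) \<boxplus>\<^bsub>G\<^esub> b)))"
  by (simp add: D1_def)

text \<open>Since \<delta>(s1(a)^b) = -b + \<delta>(s1 a) + b, the summand b moves to the right of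
  \<delta>(s1 a). In D1 a + D1 b the two \<open>s0\<close> terms at the common object cancel, which
  leaves the same sum.\<close>

lemma D1_plus [simp]:
  "\<lbrakk>a \<in> Arr G; b \<in> Arr G; \<beta>\<^bsub>G\<^esub> a = \<alpha>\<^bsub>G\<^esub> b\<rbrakk> \<Longrightarrow> D1 (a \<boxplus>\<^bsub>G\<^esub> b) = D1 a \<boxplus>\<^bsub>G\<^esub> D1 b"
  by (simp add: D1_def)

lemma D2_closed [simp]: "c \<in> Arr C \<Longrightarrow> D2 c \<in> Arr C"
  and tgt_D2 [simp]: "c \<in> Arr C \<Longrightarrow> \<beta>\<^bsub>C\<^esub> (D2 c) = D0 (\<beta>\<^bsub>C\<^esub> c)"
  by (simp_all add: D2_def)

text \<open>In c + d + s1(\<delta> c + \<delta> d) the Peiffer identity replaces s1(\<delta>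
  c)^(\<delta> d) by -d + s1(\<delta> c) + d, and -d cancels against the d before it.\<close>

lemma D2_plus [simp]:
  "\<lbrakk>c \<in> Arr C; d \<in> Arr C; \<beta>\<^bsub>C\<^esub> c = \<beta>\<^bsub>C\<^esub> d\<rbrakk> \<Longrightarrow> D2 (c \<boxplus>\<^bsub>C\<^esub> d) = D2 c \<boxplus>\<^bsub>C\<^esub> D2 d"
  by (simp add: D2_def)

lemma boundary_D2 [simp]: "c \<in> Arr C \<Longrightarrow> \<delta> (D2 c) = D1 (\<delta> c)"
  by (simp add: D1_def D2_def)

lemma act_D1:
  "\<lbrakk>c \<in> Arr C; a \<in> Arr G; \<beta>\<^bsub>C\<^esub> c = D0 (\<alpha>\<^bsub>G\<^esub> a)\<rbrakk> \<Longrightarrow>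
    act c (D1 a) = act (act (act (act c (s0 (\<alpha>\<^bsub>G\<^esub> a))) a) (\<delta> (s1 a))) (\<boxminus>\<^bsub>G\<^esub> (s0 (\<beta>\<^bsub>G\<^esub> a)))"
  by (simp add: D1_def)

text \<open>Expand s1(-a + \<delta> c + a) by the derivation rule and \<open>s1_neg\<close>. With
  the Peiffer identity, c^a + s1(\<delta>(c^a)) becomes -s1(a) + (c + s1(\<delta> c))^a + s1(a), and
  by the Peiffer identity again this is (c + s1(\<delta> c))^a acted on by \<delta>(s1 a), as
  \<open>act_D1\<close> demands.\<close>

lemma D2_act [simp]:
  "\<lbrakk>c \<in> Arr C; a \<in> Arr G; \<beta>\<^bsub>C\<^esub> c = \<alpha>\<^bsub>G\<^esub> a\<rbrakk> \<Longrightarrow> D2 (act c a) = act (D2 c) (D1 a)"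
  by (simp add: D2_def act_D1)

lemma Delta_endomorphism: "Delta C G \<delta> act (s0, s1) \<in> endomorphisms C G \<delta> act"
  by (simp add: Delta_eq endomorphisms_def groupoid_morphism_def Pi_def)

end

section \<open>Products of free derivations and multiplicativity of Delta\<close>

locale derivation_pair = s: free_derivation C G \<delta> act s0 s1 + t: free_derivation C G \<delta> act t0 t1
  for C :: "('x, 'c) gpd" and G :: "('x, 'g) gpd"
    and \<delta> :: "'c \<Rightarrow> 'g" and act :: "'c \<Rightarrow> 'g \<Rightarrow> 'c" and s0 s1 t0 t1
begin

text \<open>\<open>m0\<close> and \<open>m1\<close> are the components of s * t, named so that the
  product can itself be an instance of \<open>free_derivation\<close>.\<close>

definition m0 where "m0 = (\<lambda>x\<in>Obj G. s0 (t.D0 x) \<boxplus>\<^bsub>G\<^esub> t0 x)"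

definition m1 where "m1 = (\<lambda>a\<in>Arr G. t1 a \<boxplus>\<^bsub>C\<^esub> act (s1 (t.D1 a)) (t0 (\<beta>\<^bsub>G\<^esub> a)))"

lemma m0_apply [simp]: "x \<in> Obj G \<Longrightarrow> m0 x = s0 (t.D0 x) \<boxplus>\<^bsub>G\<^esub> t0 x"
  by (simp add: m0_def)

lemma m1_apply [simp]:
  "a \<in> Arr G \<Longrightarrow> m1 a = t1 a \<boxplus>\<^bsub>C\<^esub> act (s1 (t.D1 a)) (t0 (\<beta>\<^bsub>G\<^esub> a))"
  by (simp add: m1_def)

lemma m_extensional: "m0 \<in> extensional (Obj G)" "m1 \<in> extensional (Arr G)"
  by (simp_all add: m0_def m1_def)

lemma mult_eq: "(s0, s1) \<otimes>\<^bsub>FDer_monoid C G \<delta> act\<^esub> (t0, t1) = (m0, m1)"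
  by (simp add: FDer_monoid_def m0_def m1_def t.Delta_eq cong: restrict_cong)

text \<open>For the derivation rule at a + b, the term s1(t.D1 a) is acted on by t.D1 b + t0(\<beta>
  b), that is by t0(\<alpha> b) + b + \<delta>(t1 b). By the Peiffer identity the last factor
  conjugates by t1 b; the summand t1 b in front cancels, leaving m1(a)^b + m1(b).\<close>

sublocale m: free_derivation C G \<delta> act m0 m1
  by unfold_locales (auto simp: free_derivations_def PiE_def m_extensional t.act_D1)

lemma D0_mult [simp]: "x \<in> Obj G \<Longrightarrow> m.D0 x = s.D0 (t.D0 x)"
  by (simp add: m.D0_def del: m.src_s0)

text \<open>The boundary of s1(t.D1 a)^(t0(\<beta> a)) is \<delta>(s1(t.D1 a)) conjugated by
  t0(\<beta> a). Its leading -t0(\<beta> a) completes \<open>t.D1 a\<close>, its trailing t0(\<beta>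
  a) cancels against the final -m0(\<beta> a).\<close>

lemma D1_mult [simp]: "a \<in> Arr G \<Longrightarrow> m.D1 a = s.D1 (t.D1 a)"
  by (simp add: m.D1_def s.D1_def t.D1_plus_left)

lemma D2_mult [simp]: "c \<in> Arr C \<Longrightarrow> m.D2 c = s.D2 (t.D2 c)"
  \<comment> \<open>While \<open>t.D2\<close> is folded, \<open>boundary_D2\<close> turns
    \<delta>(t.D2 c) into t.D1(\<delta> c), the argument of \<open>s1\<close> on the other side;
    only then is \<open>t.D2\<close> expanded.\<close>
  by (simp add: m.D2_def s.D2_def) (simp add: t.D2_def)

lemma Delta_mult:
  "Delta C G \<delta> act (m0, m1) =
    Delta C G \<delta> act (s0, s1) \<otimes>\<^bsub>End_monoid C G \<delta> act\<^esub> Delta C G \<delta> act (t0, t1)"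
  by (simp add: m.Delta_eq s.Delta_eq t.Delta_eq End_monoid_def compose_def cong: restrict_cong)

end

section \<open>The monoid of free derivations\<close>

context crossed_module
begin

abbreviation "FDer \<equiv> FDer_monoid C G \<delta> act"
abbreviation "EndC \<equiv> End_monoid C G \<delta> act"
abbreviation "DeltaC \<equiv> Delta C G \<delta> act"

lemma carrier_FDer [simp]: "carrier FDer = free_derivations C G act"
  by (simp add: FDer_monoid_def)

lemma one_FDer: "\<one>\<^bsub>FDer\<^esub> = (\<lambda>x\<in>Obj G. gident G x, \<lambda>a\<in>Arr G. gident C (\<beta>\<^bsub>G\<^esub> a))"
  by (simp add: FDer_monoid_def)

lemma carrier_EndC [simp]: "carrier EndC = endomorphisms C G \<delta> act"
  by (simp add: End_monoid_def)

lemma one_EndC: "\<one>\<^bsub>EndC\<^esub> = (\<lambda>x\<in>Obj G. x, \<lambda>a\<in>Arr G. a, \<lambda>c\<in>Arr C. c)"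
  by (simp add: End_monoid_def)

lemma mult_EndC: "(f0, f1, f2) \<otimes>\<^bsub>EndC\<^esub> (g0, g1, g2) =
    (compose (Obj G) f0 g0, compose (Arr G) f1 g1, compose (Arr C) f2 g2)"
  by (simp add: End_monoid_def)

lemma free_derivationI:
  assumes "(s0, s1) \<in> free_derivations C G act"
  shows "free_derivation C G \<delta> act s0 s1"
  using assms by unfold_locales

lemma derivation_pairI:
  assumes "(s0, s1) \<in> free_derivations C G act" "(t0, t1) \<in> free_derivations C G act"
  shows "derivation_pair C G \<delta> act s0 s1 t0 t1"
  using assms by (simp add: derivation_pair_def free_derivationI)

lemma Delta_closed: "s \<in> carrier FDer \<Longrightarrow> DeltaC s \<in> carrier EndC"
  using free_derivation.Delta_endomorphism [OF free_derivationI] by (cases s) simp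

lemma one_FDer_closed: "\<one>\<^bsub>FDer\<^esub> \<in> carrier FDer"
  by (auto simp: one_FDer free_derivations_def)

lemma Delta_one: "DeltaC \<one>\<^bsub>FDer\<^esub> = \<one>\<^bsub>EndC\<^esub>"
  by (simp add: one_FDer one_EndC Delta_def cong: restrict_cong)

lemma Delta_mult:
  assumes "s \<in> carrier FDer" "t \<in> carrier FDer"
  shows "DeltaC (s \<otimes>\<^bsub>FDer\<^esub> t) = DeltaC s \<otimes>\<^bsub>EndC\<^esub> DeltaC t"
  using assms derivation_pair.Delta_mult [OF derivation_pairI]
    derivation_pair.mult_eq [OF derivation_pairI]
  by (cases s; cases t) simp

lemma FDer_mult_closed:
  assumes "s \<in> carrier FDer" "t \<in> carrier FDer"
  shows "s \<otimes>\<^bsub>FDer\<^esub> t \<in> carrier FDer"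
proof -
  obtain s0 s1 t0 t1 where [simp]: "s = (s0, s1)" "t = (t0, t1)"
    by (cases s; cases t)
  interpret derivation_pair C G \<delta> act s0 s1 t0 t1
    using assms by (intro derivation_pairI) simp_all
  show ?thesis
    using m.derivation by (simp add: mult_eq)
qed

text \<open>One bracketing evaluates s after applying Delta(u) and then Delta(t), the other after
  applying Delta(t * u); \<open>D0_mult\<close> and \<open>D1_mult\<close> identify the two.\<close>

lemma FDer_mult_assoc:
  assumes "s \<in> carrier FDer" "t \<in> carrier FDer" "u \<in> carrier FDer"
  shows "s \<otimes>\<^bsub>FDer\<^esub> t \<otimes>\<^bsub>FDer\<^esub> u = s \<otimes>\<^bsub>FDer\<^esub> (t \<otimes>\<^bsub>FDer\<^esub> u)"
proof -
  obtain s0 s1 t0 t1 u0 u1 where eqs [simp]: "s = (s0, s1)" "t = (t0, t1)" "u = (u0, u1)"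
    by (cases s; cases t; cases u)
  interpret st: derivation_pair C G \<delta> act s0 s1 t0 t1
    using assms by (intro derivation_pairI) simp_all
  interpret tu: derivation_pair C G \<delta> act t0 t1 u0 u1
    using assms by (intro derivation_pairI) simp_all
  interpret st_u: derivation_pair C G \<delta> act st.m0 st.m1 u0 u1
    by unfold_locales
  interpret s_tu: derivation_pair C G \<delta> act s0 s1 tu.m0 tu.m1
    by unfold_locales
  have "st_u.m0 = s_tu.m0"
    by (rule extensionalityI [OF st_u.m_extensional(1) s_tu.m_extensional(1)]) simp
  moreover have "st_u.m1 = s_tu.m1"
    by (rule extensionalityI [OF st_u.m_extensional(2) s_tu.m_extensional(2)]) simp
  ultimately show ?thesis
    by (simp add: st.mult_eq tu.mult_eq st_u.mult_eq s_tu.mult_eq)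
qed

lemma FDer_one_mult:
  assumes "s \<in> carrier FDer"
  shows "\<one>\<^bsub>FDer\<^esub> \<otimes>\<^bsub>FDer\<^esub> s = s"
proof -
  obtain s0 s1 where [simp]: "s = (s0, s1)"
    by (cases s)
  obtain e0 e1 where e: "\<one>\<^bsub>FDer\<^esub> = (e0, e1)" "(e0, e1) \<in> free_derivations C G act"
    using one_FDer_closed by (cases "\<one>\<^bsub>FDer\<^esub>") auto
  interpret es: derivation_pair C G \<delta> act e0 e1 s0 s1
    using assms e by (intro derivation_pairI) simp_all
  have [simp]: "x \<in> Obj G \<Longrightarrow> e0 x = gident G x" "a \<in> Arr G \<Longrightarrow> e1 a = gident C (\<beta>\<^bsub>G\<^esub> a)" for x a
    using e(1) by (auto simp: one_FDer)
  have "es.m0 = s0"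
    by (rule extensionalityI [OF es.m_extensional(1) es.t.s0_extensional]) simp
  moreover have "es.m1 = s1"
    by (rule extensionalityI [OF es.m_extensional(2) es.t.s1_extensional]) simp
  ultimately show ?thesis
    by (simp add: es.mult_eq e(1))
qed

lemma FDer_mult_one:
  assumes "s \<in> carrier FDer"
  shows "s \<otimes>\<^bsub>FDer\<^esub> \<one>\<^bsub>FDer\<^esub> = s"
proof -
  obtain s0 s1 where [simp]: "s = (s0, s1)"
    by (cases s)
  obtain e0 e1 where e: "\<one>\<^bsub>FDer\<^esub> = (e0, e1)" "(e0, e1) \<in> free_derivations C G act"
    using one_FDer_closed by (cases "\<one>\<^bsub>FDer\<^esub>") auto
  interpret se: derivation_pair C G \<delta> act s0 s1 e0 e1
    using assms e by (intro derivation_pairI) simp_all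
  have [simp]: "x \<in> Obj G \<Longrightarrow> e0 x = gident G x" "a \<in> Arr G \<Longrightarrow> e1 a = gident C (\<beta>\<^bsub>G\<^esub> a)" for x a
    using e(1) by (auto simp: one_FDer)
  \<comment> \<open>On this side s is evaluated after Delta of the identity derivation, which
    therefore has to be recognised as the identity endomorphism.\<close>
  have [simp]: "x \<in> Obj G \<Longrightarrow> se.t.D0 x = x" "a \<in> Arr G \<Longrightarrow> se.t.D1 a = a" for x a
    by (simp_all add: se.t.D0_def se.t.D1_def del: se.t.src_s0)
  have "se.m0 = s0"
    by (rule extensionalityI [OF se.m_extensional(1) se.s.s0_extensional]) simp
  moreover have "se.m1 = s1"
    by (rule extensionalityI [OF se.m_extensional(2) se.s.s1_extensional]) simp
  ultimately show ?thesis
    by (simp add: se.mult_eq e(1))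
qed

lemma monoid_FDer: "monoid FDer"
  using FDer_mult_closed FDer_mult_assoc one_FDer_closed FDer_one_mult FDer_mult_one
  by unfold_locales blast+

end

section \<open>Automorphisms and conjugation\<close>

locale crossed_endomorphism = crossed_module C G \<delta> act
  for C :: "('x, 'c) gpd" and G :: "('x, 'g) gpd"
    and \<delta> :: "'c \<Rightarrow> 'g" and act :: "'c \<Rightarrow> 'g \<Rightarrow> 'c" +
  fixes f0 :: "'x \<Rightarrow> 'x" and f1 :: "'g \<Rightarrow> 'g" and f2 :: "'c \<Rightarrow> 'c"
  assumes endomorphism: "(f0, f1, f2) \<in> endomorphisms C G \<delta> act"
begin

sublocale f1: groupoid_hom G G f0 f1
  using endomorphism by unfold_locales (simp add: endomorphisms_def)

sublocale f2: groupoid_hom C C f0 f2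
  using endomorphism by unfold_locales (simp add: endomorphisms_def)

lemma boundary_f2 [simp]: "c \<in> Arr C \<Longrightarrow> \<delta> (f2 c) = f1 (\<delta> c)"
  and f2_act [simp]: "\<lbrakk>c \<in> Arr C; a \<in> Arr G; \<beta>\<^bsub>C\<^esub> c = \<alpha>\<^bsub>G\<^esub> a\<rbrakk> \<Longrightarrow> f2 (act c a) = act (f2 c) (f1 a)"
  and f_extensional: "f0 \<in> extensional (Obj G)" "f1 \<in> extensional (Arr G)" "f2 \<in> extensional (Arr C)"
  using endomorphism by (simp_all add: endomorphisms_def)

end

context crossed_module
begin

lemma crossed_endomorphismI:
  assumes "(f0, f1, f2) \<in> carrier EndC"
  shows "crossed_endomorphism C G \<delta> act f0 f1 f2"
  using assms by unfold_locales simp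

lemma monoid_EndC: "monoid EndC"
proof
  fix f g
  assume fg: "f \<in> carrier EndC" "g \<in> carrier EndC"
  obtain f0 f1 f2 g0 g1 g2 where [simp]: "f = (f0, f1, f2)" "g = (g0, g1, g2)"
    by (cases f; cases g)
  interpret f: crossed_endomorphism C G \<delta> act f0 f1 f2
    using fg by (intro crossed_endomorphismI) simp
  interpret g: crossed_endomorphism C G \<delta> act g0 g1 g2
    using fg by (intro crossed_endomorphismI) simp
  show "f \<otimes>\<^bsub>EndC\<^esub> g \<in> carrier EndC"
    by (simp add: mult_EndC endomorphisms_def groupoid_morphism_def compose_eq Pi_def)
  fix h
  assume h: "h \<in> carrier EndC"
  obtain h0 h1 h2 where [simp]: "h = (h0, h1, h2)"
    by (cases h)
  interpret h: crossed_endomorphism C G \<delta> act h0 h1 h2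
    using h by (intro crossed_endomorphismI) simp
  show "f \<otimes>\<^bsub>EndC\<^esub> g \<otimes>\<^bsub>EndC\<^esub> h = f \<otimes>\<^bsub>EndC\<^esub> (g \<otimes>\<^bsub>EndC\<^esub> h)"
    by (simp add: mult_EndC compose_def cong: restrict_cong)
next
  show "\<one>\<^bsub>EndC\<^esub> \<in> carrier EndC"
    by (simp add: one_EndC endomorphisms_def groupoid_morphism_def Pi_def)
next
  fix f
  assume f: "f \<in> carrier EndC"
  obtain f0 f1 f2 where [simp]: "f = (f0, f1, f2)"
    by (cases f)
  interpret f: crossed_endomorphism C G \<delta> act f0 f1 f2
    using f by (intro crossed_endomorphismI) simp
  show "\<one>\<^bsub>EndC\<^esub> \<otimes>\<^bsub>EndC\<^esub> f = f"
    by (simp add: mult_EndC one_EndC compose_def extensional_restrict f.f_extensional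
        cong: restrict_cong)
  show "f \<otimes>\<^bsub>EndC\<^esub> \<one>\<^bsub>EndC\<^esub> = f"
    by (simp add: mult_EndC one_EndC compose_def extensional_restrict f.f_extensional
        cong: restrict_cong)
qed

end

text \<open>The inverse g is carried as an explicit endomorphism, so that its compatibility with
  sums, boundary and action is available as for f. The two are inverse to each other on the
  carriers.\<close>

locale crossed_automorphism =
  f: crossed_endomorphism C G \<delta> act f0 f1 f2 + g: crossed_endomorphism C G \<delta> act g0 g1 g2
  for C :: "('x, 'c) gpd" and G :: "('x, 'g) gpd"
    and \<delta> :: "'c \<Rightarrow> 'g" and act :: "'c \<Rightarrow> 'g \<Rightarrow> 'c" and f0 f1 f2 g0 g1 g2 +
  assumes f0_g0 [simp]: "x \<in> Obj G \<Longrightarrow> f0 (g0 x) = x" and g0_f0 [simp]: "x \<in> Obj G \<Longrightarrow> g0 (f0 x) = x"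
    and f1_g1 [simp]: "a \<in> Arr G \<Longrightarrow> f1 (g1 a) = a" and g1_f1 [simp]: "a \<in> Arr G \<Longrightarrow> g1 (f1 a) = a"
    and f2_g2 [simp]: "c \<in> Arr C \<Longrightarrow> f2 (g2 c) = c" and g2_f2 [simp]: "c \<in> Arr C \<Longrightarrow> g2 (f2 c) = c"
begin

lemma inv_into_f1: "a \<in> Arr G \<Longrightarrow> inv_into (Arr G) f1 a = g1 a"
  using inj_on_inverseI [of "Arr G" g1 f1] by (intro inv_into_f_eq) simp_all

lemma inv_into_f2: "c \<in> Arr C \<Longrightarrow> inv_into (Arr C) f2 c = g2 c"
  using inj_on_inverseI [of "Arr C" g2 f2] by (intro inv_into_f_eq) simp_all

definition conj0 where "conj0 s0 = (\<lambda>x\<in>Obj G. g1 (s0 (f0 x)))"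

definition conj1 where "conj1 s1 = (\<lambda>a\<in>Arr G. g2 (s1 (f1 a)))"

lemma conj0_apply [simp]: "x \<in> Obj G \<Longrightarrow> conj0 s0 x = g1 (s0 (f0 x))"
  by (simp add: conj0_def)

lemma conj1_apply [simp]: "a \<in> Arr G \<Longrightarrow> conj1 s1 a = g2 (s1 (f1 a))"
  by (simp add: conj1_def)

lemma conj_extensional: "conj0 s0 \<in> extensional (Obj G)" "conj1 s1 \<in> extensional (Arr G)"
  by (simp_all add: conj0_def conj1_def)

end

section \<open>Conjugation of free derivations by an automorphism\<close>

locale conjugate_derivation =
  crossed_automorphism C G \<delta> act f0 f1 f2 g0 g1 g2 + s: free_derivation C G \<delta> act s0 s1
  for C :: "('x, 'c) gpd" and G :: "('x, 'g) gpd"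
    and \<delta> :: "'c \<Rightarrow> 'g" and act :: "'c \<Rightarrow> 'g \<Rightarrow> 'c" and f0 f1 f2 g0 g1 g2 s0 s1
begin

text \<open>Applying g2 to the derivation rule of s at f1 a, f1 b gives an action by g1(f1 b), which
  is b again.\<close>

sublocale c: free_derivation C G \<delta> act "conj0 s0" "conj1 s1"
  by unfold_locales (auto simp: free_derivations_def PiE_def conj_extensional)

lemma D0_conj [simp]: "x \<in> Obj G \<Longrightarrow> c.D0 x = g0 (s.D0 (f0 x))"
  by (simp add: c.D0_def del: c.src_s0)

text \<open>Writing a as g1(f1 a) and using \<delta> g2 = g1 \<delta> makes every summand a value of
  g1.\<close>

lemma D1_conj [simp]: "a \<in> Arr G \<Longrightarrow> c.D1 a = g1 (s.D1 (f1 a))"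
  by (simp add: c.D1_def s.D1_def)

lemma D2_conj [simp]: "c \<in> Arr C \<Longrightarrow> c.D2 c = g2 (s.D2 (f2 c))"
  by (simp add: c.D2_def s.D2_def)

lemma Delta_conj: "Delta C G \<delta> act (conj0 s0, conj1 s1) =
    (g0, g1, g2) \<otimes>\<^bsub>End_monoid C G \<delta> act\<^esub> Delta C G \<delta> act (s0, s1)
      \<otimes>\<^bsub>End_monoid C G \<delta> act\<^esub> (f0, f1, f2)"
  by (simp add: c.Delta_eq s.Delta_eq f.mult_EndC compose_def cong: restrict_cong)

end

locale conjugate_pair =
  crossed_automorphism C G \<delta> act f0 f1 f2 g0 g1 g2 + st: derivation_pair C G \<delta> act s0 s1 t0 t1
  for C :: "('x, 'c) gpd" and G :: "('x, 'g) gpd"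
    and \<delta> :: "'c \<Rightarrow> 'g" and act :: "'c \<Rightarrow> 'g \<Rightarrow> 'c" and f0 f1 f2 g0 g1 g2 s0 s1 t0 t1
begin

sublocale s: conjugate_derivation C G \<delta> act f0 f1 f2 g0 g1 g2 s0 s1
  by unfold_locales

sublocale t: conjugate_derivation C G \<delta> act f0 f1 f2 g0 g1 g2 t0 t1
  by unfold_locales

sublocale c: derivation_pair C G \<delta> act "conj0 s0" "conj1 s1" "conj0 t0" "conj1 t1"
  by unfold_locales

text \<open>The product of the conjugates evaluates g2 s1 f1 at Delta(t^f) a = g1(t.D1(f1 a)), where
  f1 cancels g1.\<close>

lemma conj_mult: "(conj0 st.m0, conj1 st.m1) = (c.m0, c.m1)"
proof -
  have "conj0 st.m0 = c.m0"
    by (rule extensionalityI [OF conj_extensional(1) c.m_extensional(1)]) simp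
  moreover have "conj1 st.m1 = c.m1"
    by (rule extensionalityI [OF conj_extensional(2) c.m_extensional(2)]) simp
  ultimately show ?thesis
    by simp
qed

end

section \<open>The action of automorphisms on all free derivations\<close>

definition der_act ::
    "('x, 'c) gpd \<Rightarrow> ('x, 'g) gpd \<Rightarrow> ('x, 'g, 'c) deriv \<Rightarrow> ('x, 'g, 'c) endo \<Rightarrow> ('x, 'g, 'c) deriv" where
  "der_act C G = (\<lambda>(s0, s1) (f0, f1, f2).
      (\<lambda>x\<in>Obj G. inv_into (Arr G) f1 (s0 (f0 x)),
       \<lambda>a\<in>Arr G. inv_into (Arr C) f2 (s1 (f1 a))))"

text \<open>On the carriers \<open>inv_into\<close> applied to f1 and f2 agrees with the components
  g1 and g2 of the inverse automorphism.\<close>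

lemma (in conjugate_derivation) der_act_eq:
  "der_act C G (s0, s1) (f0, f1, f2) = (conj0 s0, conj1 s1)"
  by (simp add: der_act_def conj0_def conj1_def inv_into_f1 inv_into_f2 cong: restrict_cong)

context crossed_module
begin

lemma crossed_automorphismI:
  assumes f: "(f0, f1, f2) \<in> Units EndC" and inv: "inv\<^bsub>EndC\<^esub> (f0, f1, f2) = (g0, g1, g2)"
  shows "crossed_automorphism C G \<delta> act f0 f1 f2 g0 g1 g2"
proof -
  interpret E: monoid EndC
    by (rule monoid_EndC)
  interpret f: crossed_endomorphism C G \<delta> act f0 f1 f2
    by (rule crossed_endomorphismI [OF E.Units_closed [OF f]])
  interpret g: crossed_endomorphism C G \<delta> act g0 g1 g2
    by (rule crossed_endomorphismI [OF E.Units_inv_closed [OF f, unfolded inv]])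
  show ?thesis
    using E.Units_r_inv [OF f] E.Units_l_inv [OF f]
    \<comment> \<open>The two inverse laws split into equations between restricted functions, which
      are then evaluated at points of the carriers.\<close>
    unfolding inv mult_EndC one_EndC compose_def prod.inject
    by unfold_locales (metis restrict_apply')+
qed

lemma conjugate_derivationE:
  assumes "s \<in> carrier FDer" "f \<in> Units EndC"
  obtains s0 s1 f0 f1 f2 g0 g1 g2 where
    "s = (s0, s1)" "f = (f0, f1, f2)" "inv\<^bsub>EndC\<^esub> f = (g0, g1, g2)"
    "conjugate_derivation C G \<delta> act f0 f1 f2 g0 g1 g2 s0 s1"
  using assms crossed_automorphismI free_derivationI unfolding conjugate_derivation_def
  by (cases s; cases f; cases "inv\<^bsub>EndC\<^esub> f") auto

lemma der_act_closed:
  assumes "s \<in> carrier FDer" "f \<in> Units EndC"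
  shows "der_act C G s f \<in> carrier FDer"
  using assms
proof (cases rule: conjugate_derivationE)
  case (1 s0 s1 f0 f1 f2 g0 g1 g2)
  then interpret conjugate_derivation C G \<delta> act f0 f1 f2 g0 g1 g2 s0 s1
    by simp
  show ?thesis
    using c.derivation by (simp add: 1 der_act_eq)
qed

lemma Delta_der_act:
  assumes "s \<in> carrier FDer" "f \<in> Units EndC"
  shows "DeltaC (der_act C G s f) = inv\<^bsub>EndC\<^esub> f \<otimes>\<^bsub>EndC\<^esub> DeltaC s \<otimes>\<^bsub>EndC\<^esub> f"
  using assms
proof (cases rule: conjugate_derivationE)
  case (1 s0 s1 f0 f1 f2 g0 g1 g2)
  then interpret conjugate_derivation C G \<delta> act f0 f1 f2 g0 g1 g2 s0 s1
    by simp
  show ?thesis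
    \<comment> \<open>The inverse is replaced first: once \<open>f\<close> has been split into a
      triple, \<open>1(3)\<close> no longer matches.\<close>
    unfolding 1(3) unfolding 1(1,2) der_act_eq by (rule Delta_conj)
qed

lemma der_act_mult_FDer:
  assumes s: "s \<in> carrier FDer" and t: "t \<in> carrier FDer" and f: "f \<in> Units EndC"
  shows "der_act C G (s \<otimes>\<^bsub>FDer\<^esub> t) f = der_act C G s f \<otimes>\<^bsub>FDer\<^esub> der_act C G t f"
  using s f
proof (cases rule: conjugate_derivationE)
  case (1 s0 s1 f0 f1 f2 g0 g1 g2)
  obtain t0 t1 where [simp]: "t = (t0, t1)"
    by (cases t)
  interpret s: conjugate_derivation C G \<delta> act f0 f1 f2 g0 g1 g2 s0 s1
    by (rule 1)
  interpret t: free_derivation C G \<delta> act t0 t1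
    using t by (intro free_derivationI) simp
  interpret conjugate_pair C G \<delta> act f0 f1 f2 g0 g1 g2 s0 s1 t0 t1
    by unfold_locales
  interpret m: conjugate_derivation C G \<delta> act f0 f1 f2 g0 g1 g2 st.m0 st.m1
    by unfold_locales
  show ?thesis
    by (simp add: 1 st.mult_eq m.der_act_eq s.der_act_eq t.der_act_eq c.mult_eq conj_mult
        del: prod.inject)
qed

text \<open>g1 and g2 preserve identities, and g0 undoes f0. Together with
  \<open>der_act_mult_FDer\<close> this makes the action preserve units.\<close>

lemma der_act_one_FDer:
  assumes "f \<in> Units EndC"
  shows "der_act C G \<one>\<^bsub>FDer\<^esub> f = \<one>\<^bsub>FDer\<^esub>"
  using one_FDer_closed assms
proof (cases rule: conjugate_derivationE)
  case (1 e0 e1 f0 f1 f2 g0 g1 g2)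
  then interpret conjugate_derivation C G \<delta> act f0 f1 f2 g0 g1 g2 e0 e1
    by simp
  have [simp]: "x \<in> Obj G \<Longrightarrow> e0 x = gident G x" "a \<in> Arr G \<Longrightarrow> e1 a = gident C (\<beta>\<^bsub>G\<^esub> a)" for x a
    using 1(1) by (auto simp: one_FDer)
  have "conj0 e0 = e0"
    by (rule extensionalityI [OF conj_extensional(1) s.s0_extensional]) simp
  moreover have "conj1 e1 = e1"
    by (rule extensionalityI [OF conj_extensional(2) s.s1_extensional]) simp
  ultimately show ?thesis
    by (simp add: 1 der_act_eq)
qed

lemma der_act_one:
  assumes s: "s \<in> carrier FDer"
  shows "der_act C G s \<one>\<^bsub>EndC\<^esub> = s"
proof -
  interpret E: monoid EndC
    by (rule monoid_EndC)
  show ?thesis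
    using s E.Units_one_closed
  proof (cases rule: conjugate_derivationE)
    case (1 s0 s1 f0 f1 f2 g0 g1 g2)
    then interpret conjugate_derivation C G \<delta> act f0 f1 f2 g0 g1 g2 s0 s1
      by simp
    have [simp]: "x \<in> Obj G \<Longrightarrow> f0 x = x" "a \<in> Arr G \<Longrightarrow> f1 a = a"
        "a \<in> Arr G \<Longrightarrow> g1 a = a" "c \<in> Arr C \<Longrightarrow> g2 c = c" for x a c
      using 1(2,3) by (auto simp: one_EndC E.inv_one [unfolded one_EndC])
    have "conj0 s0 = s0"
      by (rule extensionalityI [OF conj_extensional(1) s.s0_extensional]) simp
    moreover have "conj1 s1 = s1"
      by (rule extensionalityI [OF conj_extensional(2) s.s1_extensional]) simp
    ultimately show ?thesis
      by (simp add: 1 der_act_eq)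
  qed
qed

text \<open>The product p q is the composite of p after q, with inverse composed in the opposite
  order. So conjugating by p q means conjugating by p first and then by q, which gives a right
  action.\<close>

lemma der_act_mult:
  assumes s: "s \<in> carrier FDer" and p: "p \<in> Units EndC" and q: "q \<in> Units EndC"
  shows "der_act C G s (p \<otimes>\<^bsub>EndC\<^esub> q) = der_act C G (der_act C G s p) q"
proof -
  interpret E: monoid EndC
    by (rule monoid_EndC)
  \<comment> \<open>The law for inverses of products is applied in the group of units, whose
    inverses agree with those of \<open>EndC\<close>.\<close>
  have inv_pq: "inv\<^bsub>EndC\<^esub> (p \<otimes>\<^bsub>EndC\<^esub> q) = inv\<^bsub>EndC\<^esub> q \<otimes>\<^bsub>EndC\<^esub> inv\<^bsub>EndC\<^esub> p"
    using group.inv_mult_group [OF E.units_group, of p q] p q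
    by (simp add: units_of_carrier units_of_mult E.units_of_inv)
  obtain s0 s1 p0 p1 p2 g0 g1 g2 where P: "s = (s0, s1)" "p = (p0, p1, p2)"
      "inv\<^bsub>EndC\<^esub> p = (g0, g1, g2)" "conjugate_derivation C G \<delta> act p0 p1 p2 g0 g1 g2 s0 s1"
    using s p by (rule conjugate_derivationE)
  interpret P: conjugate_derivation C G \<delta> act p0 p1 p2 g0 g1 g2 s0 s1
    by (rule P)
  obtain q0 q1 q2 h0 h1 h2 where Q: "q = (q0, q1, q2)" "inv\<^bsub>EndC\<^esub> q = (h0, h1, h2)"
    by (cases q; cases "inv\<^bsub>EndC\<^esub> q")
  interpret Q: crossed_automorphism C G \<delta> act q0 q1 q2 h0 h1 h2
    using q Q by (intro crossed_automorphismI) simp_all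
  interpret Q: conjugate_derivation C G \<delta> act q0 q1 q2 h0 h1 h2 "P.conj0 s0" "P.conj1 s1"
    by unfold_locales
  interpret R: crossed_automorphism C G \<delta> act
    "compose (Obj G) p0 q0" "compose (Arr G) p1 q1" "compose (Arr C) p2 q2"
    "compose (Obj G) h0 g0" "compose (Arr G) h1 g1" "compose (Arr C) h2 g2"
    using E.Units_m_closed [OF p q] inv_pq unfolding P(3) Q(2) unfolding P(2) Q(1)
    by (intro crossed_automorphismI) (simp_all add: mult_EndC)
  interpret R: conjugate_derivation C G \<delta> act
    "compose (Obj G) p0 q0" "compose (Arr G) p1 q1" "compose (Arr C) p2 q2"
    "compose (Obj G) h0 g0" "compose (Arr G) h1 g1" "compose (Arr C) h2 g2" s0 s1
    by unfold_locales
  have "R.conj0 s0 = Q.conj0 (P.conj0 s0)"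
    by (rule extensionalityI [OF R.conj_extensional(1) Q.conj_extensional(1)])
      (simp add: compose_eq)
  moreover have "R.conj1 s1 = Q.conj1 (P.conj1 s1)"
    by (rule extensionalityI [OF R.conj_extensional(2) Q.conj_extensional(2)])
      (simp add: compose_eq)
  ultimately show ?thesis
    by (simp add: P(1,2) Q(1) mult_EndC P.der_act_eq Q.der_act_eq R.der_act_eq)
qed

end

section \<open>Restriction to the groups of units\<close>

lemma Units_image:
  assumes "u \<in> Units M" and closed: "\<And>x. x \<in> carrier M \<Longrightarrow> h x \<in> carrier N"
    and mult: "\<And>x y. \<lbrakk>x \<in> carrier M; y \<in> carrier M\<rbrakk> \<Longrightarrow> h (x \<otimes>\<^bsub>M\<^esub> y) = h x \<otimes>\<^bsub>N\<^esub> h y"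
    and one: "h \<one>\<^bsub>M\<^esub> = \<one>\<^bsub>N\<^esub>"
  shows "h u \<in> Units N"
proof -
  obtain v where "u \<in> carrier M" "v \<in> carrier M" "u \<otimes>\<^bsub>M\<^esub> v = \<one>\<^bsub>M\<^esub>" "v \<otimes>\<^bsub>M\<^esub> u = \<one>\<^bsub>M\<^esub>"
    using assms(1) by (auto simp: Units_def)
  then show ?thesis
    using closed mult one unfolding Units_def by (smt (verit, best) mem_Collect_eq)
qed

text \<open>The algebraic laws are already known for all free derivations. It remains to see that
  Delta and the action send units to units, both by \<open>Units_image\<close>, and that each
  automorphism acts bijectively.\<close>

lemma (in crossed_module) pre_crossed_module_FDer_star:
  "pre_crossed_module (FDer_star C G \<delta> act) (Aut_group C G \<delta> act) DeltaC (der_act C G)"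
proof -
  interpret M: monoid FDer
    by (rule monoid_FDer)
  interpret E: monoid EndC
    by (rule monoid_EndC)
  have act_Units: "der_act C G s f \<in> Units FDer" if "s \<in> Units FDer" "f \<in> Units EndC" for s f
    using that by (intro Units_image [where M = FDer and h = "\<lambda>s. der_act C G s f"])
      (auto intro: der_act_closed der_act_mult_FDer der_act_one_FDer simp del: carrier_FDer)
  have Delta_Units: "DeltaC s \<in> Units EndC" if "s \<in> Units FDer" for s
    using that Delta_closed Delta_mult Delta_one by (rule Units_image)
  have act_bij: "bij_betw (\<lambda>s. der_act C G s f) (Units FDer) (Units FDer)"
    if f: "f \<in> Units EndC" for f
  \<comment> \<open>The inverse map is the action of the inverse automorphism: both composites are
    the action of the identity by \<open>der_act_mult\<close>.\<close>
  proof (rule bij_betwI [where g = "\<lambda>s. der_act C G s (inv\<^bsub>EndC\<^esub> f)"])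
    fix s
    assume s: "s \<in> Units FDer"
    show "der_act C G (der_act C G s f) (inv\<^bsub>EndC\<^esub> f) = s"
      "der_act C G (der_act C G s (inv\<^bsub>EndC\<^esub> f)) f = s"
      using f M.Units_closed [OF s] by (simp_all add: der_act_one flip: der_act_mult)
  qed (use f act_Units in auto)
  show ?thesis
    unfolding FDer_star_def Aut_group_def
  proof (intro pre_crossed_module.intro right_group_action.intro right_group_action_axioms.intro
      pre_crossed_module_axioms.intro M.units_group E.units_group)
    show "(\<lambda>s. der_act C G s f) \<in> iso (units_of FDer) (units_of FDer)"
      if "f \<in> carrier (units_of EndC)" for f
      using that act_bij act_Units der_act_mult_FDer M.Units_closed
      by (auto simp: iso_def hom_def units_of_def simp del: carrier_FDer)
    show "der_act C G s \<one>\<^bsub>units_of EndC\<^esub> = s" if "s \<in> carrier (units_of FDer)" for s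
      using that der_act_one M.Units_closed by (simp add: units_of_def del: carrier_FDer)
    show "der_act C G s (p \<otimes>\<^bsub>units_of EndC\<^esub> q) = der_act C G (der_act C G s p) q"
      if "s \<in> carrier (units_of FDer)" "p \<in> carrier (units_of EndC)"
        "q \<in> carrier (units_of EndC)" for s p q
      using that der_act_mult M.Units_closed by (simp add: units_of_def del: carrier_FDer)
    show "DeltaC \<in> hom (units_of FDer) (units_of EndC)"
      using Delta_Units Delta_mult M.Units_closed
      by (auto simp: hom_def units_of_def simp del: carrier_FDer)
    show "DeltaC (der_act C G s f) =
        inv\<^bsub>units_of EndC\<^esub> f \<otimes>\<^bsub>units_of EndC\<^esub> DeltaC s \<otimes>\<^bsub>units_of EndC\<^esub> f"
      if "s \<in> carrier (units_of FDer)" "f \<in> carrier (units_of EndC)" for s f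
    proof -
      have "s \<in> carrier FDer" "f \<in> Units EndC"
        using that M.Units_closed by (auto simp: units_of_def simp del: carrier_FDer)
      then show ?thesis
        by (simp add: Delta_der_act E.units_of_inv units_of_mult del: carrier_FDer)
    qed
  qed
qed

theorem theorem2p6:
  fixes C :: "('x, 'c) gpd" and G :: "('x, 'g) gpd"
    and \<delta> :: "'c \<Rightarrow> 'g" and act :: "'c \<Rightarrow> 'g \<Rightarrow> 'c"
  assumes "crossed_module C G \<delta> act"
  shows "pre_crossed_module (FDer_star C G \<delta> act) (Aut_group C G \<delta> act) (Delta C G \<delta> act)
    (\<lambda>(s0, s1) (f0, f1, f2).
      (\<lambda>x\<in>Obj G. inv_into (Arr G) f1 (s0 (f0 x)),
       \<lambda>a\<in>Arr G. inv_into (Arr C) f2 (s1 (f1 a))))"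
  using crossed_module.pre_crossed_module_FDer_star [OF assms] unfolding der_act_def .

end
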